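(* Let $I\subset S=\mathbb{K}[x_1,\dots,x_n]$ be a monomial ideal that is $w$-stable for some weight vector $w$. Then $Bgens_w(I)\subseteq Bgens(I)$.
   Context: Let $\mathbb{K}$ be a field, $S=\mathbb{K}[x_1,\dots,x_n]$, $R=\mathbb{K}[y_1,\dots,y_n]$. A weight vector is $w=(w_1,\dots,w_n)$ of positive integers with $w_1\ge w_2\ge\dots\ge w_n$. Let $\psi:S\to R$ be the $\mathbb{K}$-algebra homomorphism with $\psi(x_i)=y_i^{w_i}$. A Borel move on a monomial $m$ in a polynomial ring with variables $z_1>\dots>z_n$ sends $m$ to $m\cdot\frac{z_{i_1}}{z_{j_1}}\cdots\frac{z_{i_s}}{z_{j_s}}$, where $i_t<j_t$ for all $t$ and $z_{j_1}\cdots z_{j_s}$ divides $m$. A monomial ideal is strongly stable if it is closed under Borel moves on its monomials. For a set $T$ of monomials, $Borel(T)$ is the smallest strongly stable ideal containing $T$. For a monomial ideal $I\subset S$, $Borel(\psi(I))$ is the smallest strongly stable ideal of $R$ containing $\psi(u)$ for all monomials $u\in I$, and $\overline{I}:=\psi^{-1}(Borel(\psi(I)))$. A monomial ideal $I\subset S$ is $w$-stable if $I=\overline{I}$; such an ideal is strongly stable. Every strongly stable ideal $J$ (in $S$ or in $R$) has a unique minimal set of Borel generators $Bgens(J)$: the unique inclusion-minimal set of monomials $T$ with $Borel(T)=J$. For a $w$-stable ideal $I\subset S$, the set of weighted Borel generators is $Bgens_w(I)=\psi^{-1}(Bgens(Borel(\psi(I))))$, i.e. the set of monomials $u\in S$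 with $\psi(u)\in Bgens(Borel(\psi(I)))$. *)

theory Defs
  imports Complex_Main "HOL-Library.Poly_Mapping"
begin

text \<open>
  The polynomial ring in finitely many linearly ordered variables indexed by \<open>'n\<close>, with
  coefficients in \<open>'k\<close>. The indices \<open>i < j\<close> of \<open>'n\<close> correspond to the variables
  \<open>z\<^sub>i > z\<^sub>j\<close>. An element maps exponent vectors to coefficients. The rings \<open>S\<close> and \<open>R\<close>
  are two copies of this ring.
\<close>

type_synonym ('n, 'k) mpoly = "('n \<Rightarrow>\<^sub>0 nat) \<Rightarrow>\<^sub>0 'k"

definition var :: "'n \<Rightarrow> ('n, 'k::comm_ring_1) mpoly"
  where "var i = Poly_Mapping.single (Poly_Mapping.single i 1) 1"

definition const :: "'k \<Rightarrow> ('n, 'k::comm_ring_1) mpoly"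
  where "const c = Poly_Mapping.single 0 c"

definition monomials :: "('n, 'k::comm_ring_1) mpoly set"
  where "monomials = range (\<lambda>a. Poly_Mapping.single a 1)"

text \<open>An ideal is a submodule of the ring acting on itself by multiplication.\<close>

lemma module_mult: "module ((*) :: 'a \<Rightarrow> 'a \<Rightarrow> 'a::comm_ring_1)"
  by standard (simp_all add: algebra_simps)

abbreviation is_ideal :: "'a::comm_ring_1 set \<Rightarrow> bool"
  where "is_ideal \<equiv> module.subspace (*)"

abbreviation ideal_generated :: "'a::comm_ring_1 set \<Rightarrow> 'a set"
  where "ideal_generated \<equiv> module.span (*)"

definition monomial_ideal :: "('n, 'k::field) mpoly set \<Rightarrow> bool"
  where "monomial_ideal I \<longleftrightarrow> (\<exists>T \<subseteq> monomials. I = ideal_generated T)"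

text \<open>
  For a monomial \<open>u\<close>, the product of the \<open>var j\<close> divides \<open>u\<close> with quotient \<open>c\<close>; the
  list \<open>ps\<close> holds the pairs \<open>(i\<^sub>t, j\<^sub>t)\<close>.
\<close>

definition borel_move :: "('n::linorder, 'k::field) mpoly \<Rightarrow> ('n, 'k) mpoly \<Rightarrow> bool"
  where "borel_move u v \<longleftrightarrow>
    (\<exists>ps. \<exists>c \<in> monomials. (\<forall>(i, j) \<in> set ps. i < j) \<and>
      u = c * (\<Prod>(i, j)\<leftarrow>ps. var j) \<and> v = c * (\<Prod>(i, j)\<leftarrow>ps. var i))"

definition strongly_stable :: "('n::linorder, 'k::field) mpoly set \<Rightarrow> bool"
  where "strongly_stable J \<longleftrightarrow>
    monomial_ideal J \<and> (\<forall>u \<in> J \<inter> monomials. \<forall>v. borel_move u v \<longrightarrow> v \<in> J)"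

text \<open>The lemmas \<open>strongly_stable_Borel\<close>, \<open>Borel_superset\<close> and \<open>Borel_least\<close> below show that
  this is the smallest strongly stable ideal containing \<open>T\<close>.\<close>

definition Borel :: "('n::linorder, 'k::field) mpoly set \<Rightarrow> ('n, 'k) mpoly set"
  where "Borel T = \<Inter>{J. strongly_stable J \<and> T \<subseteq> J}"

definition minimal_Borel_generators ::
    "('n::linorder, 'k::field) mpoly set \<Rightarrow> ('n, 'k) mpoly set \<Rightarrow> bool"
  where "minimal_Borel_generators J T \<longleftrightarrow>
    T \<subseteq> monomials \<and> Borel T = J \<and> (\<forall>T'. T' \<subset> T \<longrightarrow> Borel T' \<noteq> J)"

text \<open>The lemma \<open>minimal_Borel_generators_ex1\<close> below shows that the description is proper for
  every strongly stable ideal \<open>J\<close>.\<close>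

definition Bgens :: "('n::linorder, 'k::field) mpoly set \<Rightarrow> ('n, 'k) mpoly set"
  where "Bgens J = (THE T. minimal_Borel_generators J T)"

definition weight_vector :: "('n::linorder \<Rightarrow> nat) \<Rightarrow> bool"
  where "weight_vector w \<longleftrightarrow> (\<forall>i. 0 < w i) \<and> antimono w"

text \<open>The substitution \<open>x\<^sub>i \<mapsto> y\<^sub>i ^ w\<^sub>i\<close>; it is the \<open>K\<close>-algebra homomorphism with these
  values on the variables (lemmas \<open>psi_add\<close>, \<open>psi_mult\<close>, \<open>psi_const\<close>, \<open>psi_var\<close>).\<close>

definition psi :: "('n::finite \<Rightarrow> nat) \<Rightarrow> ('n, 'k::field) mpoly \<Rightarrow> ('n, 'k) mpoly"
  where "psi w f =
    (\<Sum>a \<in> Poly_Mapping.keys f.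
      const (Poly_Mapping.lookup f a) * (\<Prod>i \<in> UNIV. (var i ^ w i) ^ Poly_Mapping.lookup a i))"

definition Borel_psi ::
    "('n::{finite,linorder} \<Rightarrow> nat) \<Rightarrow> ('n, 'k::field) mpoly set \<Rightarrow> ('n, 'k) mpoly set"
  where "Borel_psi w I = Borel (psi w ` (I \<inter> monomials))"

definition w_closure ::
    "('n::{finite,linorder} \<Rightarrow> nat) \<Rightarrow> ('n, 'k::field) mpoly set \<Rightarrow> ('n, 'k) mpoly set"
  where "w_closure w I = psi w -` Borel_psi w I"

definition w_stable :: "('n::{finite,linorder} \<Rightarrow> nat) \<Rightarrow> ('n, 'k::field) mpoly set \<Rightarrow> bool"
  where "w_stable w I \<longleftrightarrow> monomial_ideal I \<and> I = w_closure w I"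

definition weighted_Bgens ::
    "('n::{finite,linorder} \<Rightarrow> nat) \<Rightarrow> ('n, 'k::field) mpoly set \<Rightarrow> ('n, 'k) mpoly set"
  where "weighted_Bgens w I = {u \<in> monomials. psi w u \<in> Bgens (Borel_psi w I)}"


subsection \<open>The map psi is a homomorphism of algebras\<close>

lemma psi_superset:
  assumes "finite A" "Poly_Mapping.keys f \<subseteq> A"
  shows "psi w f = (\<Sum>a \<in> A. const (Poly_Mapping.lookup f a) *
           (\<Prod>i \<in> UNIV. (var i ^ w i) ^ Poly_Mapping.lookup a i))"
  unfolding psi_def
  by (rule sum.mono_neutral_left) (use assms in \<open>auto simp: in_keys_iff const_def\<close>)

lemma psi_add: "psi w (f + g) = psi w f + psi w g"
proof -
  let ?A = "Poly_Mapping.keys f \<union> Poly_Mapping.keys g"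
  have "Poly_Mapping.keys (f + g) \<subseteq> ?A" by (rule keys_add)
  then show ?thesis
    by (simp add: psi_superset[of ?A] lookup_add const_def single_add distrib_right sum.distrib)
qed

lemma psi_zero: "psi w 0 = 0"
  by (simp add: psi_def)

lemma psi_sum: "psi w (\<Sum>x\<in>A. f x) = (\<Sum>x\<in>A. psi w (f x))"
  by (induction A rule: infinite_finite_induct) (simp_all add: psi_zero psi_add)

lemma psi_single:
  "psi w (Poly_Mapping.single a c) =
    const c * (\<Prod>i \<in> UNIV. (var i ^ w i) ^ Poly_Mapping.lookup a i)"
  by (subst psi_superset[of "{a}"]) auto

lemma sum_singles:
  "(\<Sum>a \<in> Poly_Mapping.keys f. Poly_Mapping.single a (Poly_Mapping.lookup f a)) = f"
  by (rule poly_mapping_eqI) (auto simp: lookup_sum lookup_single when_def in_keys_iff)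

lemma const_mult: "const (c * d) = const c * const d"
  by (simp add: const_def mult_single)

lemma psi_mult: "psi w (f * g) = psi w f * psi w g"
proof -
  let ?s = "\<lambda>f a. Poly_Mapping.single a (Poly_Mapping.lookup f a)"
  have single: "psi w (Poly_Mapping.single a c * Poly_Mapping.single b d) =
      psi w (Poly_Mapping.single a c) * psi w (Poly_Mapping.single b d)" for a b and c d :: 'b
    by (simp add: mult_single psi_single lookup_add power_add prod.distrib const_mult mult_ac)
  have "psi w (f * g) =
      psi w ((\<Sum>a \<in> Poly_Mapping.keys f. ?s f a) * (\<Sum>b \<in> Poly_Mapping.keys g. ?s g b))"
    by (simp only: sum_singles)
  also have "\<dots> = (\<Sum>a \<in> Poly_Mapping.keys f. psi w (?s f a)) *
      (\<Sum>b \<in> Poly_Mapping.keys g. psi w (?s g b))"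
    by (simp only: sum_product psi_sum single)
  also have "\<dots> = psi w f * psi w g"
    by (simp only: psi_sum[symmetric] sum_singles)
  finally show ?thesis .
qed

lemma psi_const: "psi w (const c) = const c"
  by (subst (1) const_def) (simp add: psi_single)

lemma psi_var: "psi w (var i) = var i ^ w i"
proof -
  have "(\<Prod>j \<in> UNIV. (var j ^ w j) ^ Poly_Mapping.lookup (Poly_Mapping.single i 1) j) =
      (\<Prod>j \<in> UNIV. if j = i then var i ^ w i else (1 :: ('a, 'b) mpoly))"
    by (rule prod.cong) (auto simp: lookup_single when_def)
  then show ?thesis
    by (simp add: var_def psi_single const_def)
qed


subsection \<open>The smallest strongly stable ideal containing a set\<close>

lemma monomial_ideal_iff:
  "monomial_ideal I \<longleftrightarrow>
    is_ideal I \<and> (\<forall>f \<in> I. \<forall>a \<in> Poly_Mapping.keys f. Poly_Mapping.single a 1 \<in> I)"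
  (is "?L \<longleftrightarrow> ?R")
proof
  assume ?L
  then obtain T where T: "T \<subseteq> monomials" and I: "I = ideal_generated T"
    by (auto simp: monomial_ideal_def)
  have "\<forall>a \<in> Poly_Mapping.keys f. Poly_Mapping.single a 1 \<in> I" if "f \<in> ideal_generated T" for f
    using that
  proof (induction rule: module.span_induct_alt[OF module_mult, consumes 1, case_names base step])
    case (step c t g)
    obtain b where t: "t = Poly_Mapping.single b 1"
      using step T by (auto simp: monomials_def)
    have "Poly_Mapping.single a 1 \<in> I" if key: "a \<in> Poly_Mapping.keys (c * t)" for a
    proof -
      obtain k where "a = k + b"
        using key keys_mult[of c t] by (auto simp: t split: if_splits)
      then have "Poly_Mapping.single a 1 = Poly_Mapping.single k 1 * t"
        by (simp add: t mult_single)
      then show ?thesis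
        using step I module.span_base[OF module_mult] module.span_scale[OF module_mult] by metis
    qed
    then show ?case
      using step keys_add[of "c * t" g] by blast
  qed auto
  then show ?R
    by (auto simp: I module.subspace_span[OF module_mult])
next
  assume R: ?R
  have "f \<in> ideal_generated (I \<inter> monomials)" if "f \<in> I" for f
  proof -
    have "(\<Sum>a \<in> Poly_Mapping.keys f.
        const (Poly_Mapping.lookup f a) * Poly_Mapping.single a 1) \<in> ideal_generated (I \<inter> monomials)"
      using R that
      by (intro module.span_sum[OF module_mult] module.span_scale[OF module_mult] module.span_base[OF module_mult]) (auto simp: monomials_def)
    then show ?thesis
      by (simp add: const_def mult_single sum_singles)
  qed
  moreover have "ideal_generated (I \<inter> monomials) \<subseteq> I"
    using R by (intro module.span_minimal[OF module_mult]) auto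
  ultimately show ?L
    unfolding monomial_ideal_def by (intro exI[of _ "I \<inter> monomials"]) auto
qed

lemma strongly_stable_Inter:
  assumes "\<And>J. J \<in> F \<Longrightarrow> strongly_stable J"
  shows "strongly_stable (\<Inter>F)"
  using assms unfolding strongly_stable_def monomial_ideal_iff
  by (auto intro!: module.subspace_Inter[OF module_mult])

lemma strongly_stable_Borel: "strongly_stable (Borel T)"
  unfolding Borel_def by (rule strongly_stable_Inter) auto

lemma Borel_superset: "T \<subseteq> Borel T"
  by (auto simp: Borel_def)

lemma Borel_least: "strongly_stable J \<Longrightarrow> T \<subseteq> J \<Longrightarrow> Borel T \<subseteq> J"
  by (auto simp: Borel_def)


subsection \<open>Existence and uniqueness of minimal Borel generators\<close>

lemma monomial_ideal_memI:
  assumes "monomial_ideal I" "\<And>a. a \<in> Poly_Mapping.keys f \<Longrightarrow> Poly_Mapping.single a 1 \<in> I"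
  shows "f \<in> I"
proof -
  have I: "is_ideal I"
    using assms(1) by (simp add: monomial_ideal_iff)
  have "(\<Sum>a \<in> Poly_Mapping.keys f. const (Poly_Mapping.lookup f a) * Poly_Mapping.single a 1) \<in> I"
    using assms(2)
    by (intro module.subspace_sum[OF module_mult I] module.subspace_scale[OF module_mult I])
  then show ?thesis
    by (simp add: const_def mult_single sum_singles)
qed

text \<open>A positive grading that Borel moves strictly increase.\<close>

definition height :: "('n::{finite,linorder} \<Rightarrow>\<^sub>0 nat) \<Rightarrow> nat"
  where "height a = (\<Sum>i \<in> UNIV. card {i..} * Poly_Mapping.lookup a i)"

lemma height_add: "height (a + b) = height a + height b"
  by (simp add: height_def lookup_add distrib_left sum.distrib)

lemma height_zero: "height 0 = 0"
  by (simp add: height_def)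

lemma height_single: "height (Poly_Mapping.single i 1) = card {i..}"
proof -
  have "height (Poly_Mapping.single i 1) = (\<Sum>j \<in> UNIV. if j = i then card {i..} else 0)"
    unfolding height_def by (rule sum.cong) (auto simp: lookup_single when_def)
  then show ?thesis by simp
qed

lemma height_pos: "a \<noteq> 0 \<Longrightarrow> 0 < height a"
proof -
  assume "a \<noteq> 0"
  then obtain i where i: "Poly_Mapping.lookup a i \<noteq> 0"
    by (metis lookup_zero poly_mapping_eqI)
  have "0 < card {i..}"
    unfolding card_gt_0_iff by auto
  then have "0 < card {i..} * Poly_Mapping.lookup a i"
    using i by simp
  also have "\<dots> \<le> height a"
    unfolding height_def by (rule member_le_sum) auto
  finally show ?thesis .
qed

lemma prod_var_fst: "(\<Prod>(i, j)\<leftarrow>ps. var i) =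
    Poly_Mapping.single (\<Sum>(i, j)\<leftarrow>ps. Poly_Mapping.single i 1) 1"
  by (induction ps) (auto simp: var_def mult_single)

lemma prod_var_snd: "(\<Prod>(i, j)\<leftarrow>ps. var j) =
    Poly_Mapping.single (\<Sum>(i, j)\<leftarrow>ps. Poly_Mapping.single j 1) 1"
  by (induction ps) (auto simp: var_def mult_single)

lemma height_pairs:
  assumes "\<forall>(i, j) \<in> set ps. i < j"
  shows "ps = [] \<or> height (\<Sum>(i, j)\<leftarrow>ps. Poly_Mapping.single j 1) <
    height (\<Sum>(i, j)\<leftarrow>ps. Poly_Mapping.single i 1)"
  using assms
proof (induction ps)
  case (Cons p ps)
  obtain i j where p: "p = (i, j)" by fastforce
  have "card {j..} < card {i..}"
    using Cons.prems by (intro psubset_card_mono) (auto simp: p finite_subset[OF subset_UNIV])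
  then show ?case
    using Cons by (auto simp: p height_add height_single[unfolded One_nat_def])
qed simp

lemma borel_move_height:
  assumes "borel_move (Poly_Mapping.single a 1) v"
  shows "\<exists>b. v = Poly_Mapping.single b 1 \<and> (b = a \<or> height a < height b)"
proof -
  obtain ps c where ps: "\<forall>(i, j) \<in> set ps. i < j"
    and a: "Poly_Mapping.single a 1 =
      Poly_Mapping.single (c + (\<Sum>(i, j)\<leftarrow>ps. Poly_Mapping.single j 1)) (1::'b)"
    and v: "v = Poly_Mapping.single (c + (\<Sum>(i, j)\<leftarrow>ps. Poly_Mapping.single i 1)) 1"
    using assms by (auto simp: borel_move_def monomials_def prod_var_fst prod_var_snd mult_single)
  have "a = c + (\<Sum>(i, j)\<leftarrow>ps. Poly_Mapping.single j 1)"
    using arg_cong[OF a, of Poly_Mapping.keys] by simp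
  then show ?thesis
    using height_pairs[OF ps] v by (auto simp: height_add)
qed

lemma is_ideal_keys:
  assumes "\<And>a k. P a \<Longrightarrow> P (k + a)"
  shows "is_ideal {f :: ('n, 'k::field) mpoly. \<forall>a \<in> Poly_Mapping.keys f. P a}"
  unfolding module.subspace_def[OF module_mult]
proof (intro conjI ballI allI)
  fix f g :: "('n, 'k) mpoly"
  assume "f \<in> {f. \<forall>a \<in> Poly_Mapping.keys f. P a}" "g \<in> {f. \<forall>a \<in> Poly_Mapping.keys f. P a}"
  then show "f + g \<in> {f. \<forall>a \<in> Poly_Mapping.keys f. P a}"
    using keys_add[of f g] by blast
next
  fix c f :: "('n, 'k) mpoly"
  assume "f \<in> {f. \<forall>a \<in> Poly_Mapping.keys f. P a}"
  then show "c * f \<in> {f. \<forall>a \<in> Poly_Mapping.keys f. P a}"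
    using keys_mult[of c f] assms by blast
qed simp

lemma strongly_stable_keys:
  assumes "\<And>a k. P a \<Longrightarrow> P (k + a)"
    and "\<And>a b. P a \<Longrightarrow> borel_move (Poly_Mapping.single a 1)
      (Poly_Mapping.single b 1 :: ('n::{finite,linorder}, 'k::field) mpoly) \<Longrightarrow> P b"
  shows "strongly_stable {f :: ('n, 'k) mpoly. \<forall>a \<in> Poly_Mapping.keys f. P a}"
  unfolding strongly_stable_def monomial_ideal_iff
proof (intro conjI is_ideal_keys assms(1))
  show "\<forall>u \<in> {f. \<forall>a \<in> Poly_Mapping.keys f. P a} \<inter> monomials.
      \<forall>v. borel_move u v \<longrightarrow> v \<in> {f :: ('n, 'k) mpoly. \<forall>a \<in> Poly_Mapping.keys f. P a}"
  proof (intro ballI allI impI)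
    fix u v :: "('n, 'k) mpoly"
    assume u: "u \<in> {f. \<forall>a \<in> Poly_Mapping.keys f. P a} \<inter> monomials" and uv: "borel_move u v"
    from u obtain a where a: "u = Poly_Mapping.single a 1" "P a"
      by (auto simp: monomials_def)
    from uv obtain b where "v = Poly_Mapping.single b 1"
      unfolding a using borel_move_height by blast
    then show "v \<in> {f. \<forall>a \<in> Poly_Mapping.keys f. P a}"
      using assms(2)[of a b] uv a by simp
  qed
qed auto

lemma Borel_single_height:
  fixes a b :: "'n::{finite,linorder} \<Rightarrow>\<^sub>0 nat"
  assumes "Poly_Mapping.single b 1 \<in> Borel {Poly_Mapping.single a (1::'k::field)}"
  shows "b = a \<or> height a < height b"
proof -
  let ?J = "{f :: ('n, 'k) mpoly. \<forall>b \<in> Poly_Mapping.keys f. b = a \<or> height a < height b}"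
  have "strongly_stable ?J"
  proof (rule strongly_stable_keys)
    show "k + b = a \<or> height a < height (k + b)" if "b = a \<or> height a < height b" for b k
      using that height_pos[of k] by (cases "k = 0") (auto simp: height_add)
    show "c = a \<or> height a < height c" if b: "b = a \<or> height a < height b"
      and bc: "borel_move (Poly_Mapping.single b 1) (Poly_Mapping.single c 1 :: ('n, 'k) mpoly)" for b c
    proof -
      obtain d where d: "Poly_Mapping.single c 1 = Poly_Mapping.single d (1::'k)"
        "d = b \<or> height b < height d"
        using borel_move_height[OF bc] by blast
      have "c = d"
        using arg_cong[OF d(1), of Poly_Mapping.keys] by simp
      then show ?thesis
        using b d(2) by auto
    qed
  qed
  then have "Borel {Poly_Mapping.single a 1} \<subseteq> ?J"
    by (rule Borel_least) simp
  then show ?thesis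
    using assms by auto
qed

lemma Borel_trans: "u \<in> Borel {v} \<Longrightarrow> v \<in> Borel T \<Longrightarrow> u \<in> Borel T"
  using Borel_least[OF strongly_stable_Borel, of "{v}" T] by auto

lemma Borel_pointwise:
  fixes u :: "('n::{finite,linorder}, 'k::field) mpoly"
  assumes "T \<subseteq> monomials" "u \<in> Borel T" "u \<in> monomials"
  shows "\<exists>t \<in> T. u \<in> Borel {t}"
proof -
  let ?P = "\<lambda>a. \<exists>t \<in> T. Poly_Mapping.single a 1 \<in> Borel {t}"
  have "strongly_stable {f :: ('n, 'k) mpoly. \<forall>a \<in> Poly_Mapping.keys f. ?P a}"
  proof (rule strongly_stable_keys)
    show "?P (k + a)" if "?P a" for a k
    proof -
      have "Poly_Mapping.single (k + a) (1::'k) =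
          Poly_Mapping.single k 1 * Poly_Mapping.single a 1"
        by (simp add: mult_single)
      then show ?thesis
        using that strongly_stable_Borel module.subspace_scale[OF module_mult]
        unfolding strongly_stable_def monomial_ideal_iff by metis
    qed
    show "?P b" if "?P a"
      "borel_move (Poly_Mapping.single a 1) (Poly_Mapping.single b 1 :: ('n, 'k) mpoly)" for a b
      using that strongly_stable_Borel unfolding strongly_stable_def monomials_def by blast
  qed
  moreover have "T \<subseteq> {f. \<forall>a \<in> Poly_Mapping.keys f. ?P a}"
    using assms(1) Borel_superset by (fastforce simp: monomials_def)
  ultimately have "Borel T \<subseteq> {f. \<forall>a \<in> Poly_Mapping.keys f. ?P a}"
    by (rule Borel_least)
  then show ?thesis
    using assms by (auto simp: monomials_def)
qed

theorem minimal_Borel_generators_ex1: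
  fixes J :: "('n::{finite,linorder}, 'k::field) mpoly set"
  assumes J: "strongly_stable J"
  shows "\<exists>!T. minimal_Borel_generators J T"
proof -
  define M where "M = {u \<in> J \<inter> monomials. \<forall>v \<in> J \<inter> monomials. u \<in> Borel {v} \<longrightarrow> v = u}"
  have above: "\<exists>m \<in> M. Poly_Mapping.single a 1 \<in> Borel {m}"
    if "Poly_Mapping.single a 1 \<in> J" for a
    using that
  proof (induction "height a" arbitrary: a rule: less_induct)
    case less
    show ?case
    proof (cases "Poly_Mapping.single a 1 \<in> M")
      case True
      then show ?thesis using Borel_superset by blast
    next
      case False
      then obtain b where b: "Poly_Mapping.single b 1 \<in> J"
        "Poly_Mapping.single a 1 \<in> Borel {Poly_Mapping.single b (1::'k)}" "b \<noteq> a"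
        using less.prems by (auto simp: M_def monomials_def)
      then have "height b < height a"
        using Borel_single_height by blast
      then show ?thesis
        using less.hyps b Borel_trans by blast
    qed
  qed
  have "Borel M = J"
  proof
    show "Borel M \<subseteq> J"
      by (rule Borel_least[OF J]) (auto simp: M_def)
    show "J \<subseteq> Borel M"
    proof
      fix f assume f: "f \<in> J"
      show "f \<in> Borel M"
      proof (rule monomial_ideal_memI)
        show "monomial_ideal (Borel M)"
          using strongly_stable_Borel by (auto simp: strongly_stable_def)
        fix a assume "a \<in> Poly_Mapping.keys f"
        then have "Poly_Mapping.single a 1 \<in> J"
          using f J by (auto simp: strongly_stable_def monomial_ideal_iff)
        then obtain m where "m \<in> M" "Poly_Mapping.single a 1 \<in> Borel {m}"
          using above by blast
        then show "Poly_Mapping.single a 1 \<in> Borel M"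
          using Borel_trans Borel_superset by blast
      qed
    qed
  qed
  moreover have least: "M \<subseteq> T" if T: "T \<subseteq> monomials" "Borel T = J" for T
  proof
    fix m assume m: "m \<in> M"
    then obtain t where "t \<in> T" "m \<in> Borel {t}"
      using Borel_pointwise[of T m] T by (auto simp: M_def)
    then show "m \<in> T"
      using m T Borel_superset[of T] by (auto simp: M_def)
  qed
  moreover have "M \<subseteq> monomials"
    by (auto simp: M_def)
  ultimately show ?thesis
    unfolding minimal_Borel_generators_def by (intro ex1I[of _ M]) blast+
qed

end

theory Submission
  imports Defs
begin

text \<open>
  Since the weights decrease, a Borel move \<open>u \<mapsto> v\<close> in \<open>S\<close> lifts to Borel moves in \<open>R\<close>
  from \<open>\<psi>(u)\<close> to a divisor of \<open>\<psi>(v)\<close>: the factor \<open>y\<^sub>j\<close> to the power \<open>w\<^sub>j\<close> moves to \<open>y\<^sub>i\<close> to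
  the power \<open>w\<^sub>j\<close>, where \<open>w\<^sub>j \<le> w\<^sub>i\<close>. Hence preimages of strongly stable ideals are strongly
  stable, and \<open>u \<in> Borel({v})\<close> implies \<open>\<psi>(u) \<in> Borel({\<psi>(v)})\<close>. As Borel generators are the
  monomials that lie in no \<open>Borel({v})\<close> for another monomial \<open>v\<close> of the ideal, and \<open>\<psi>\<close> is
  injective on monomials, a monomial of \<open>I\<close> with image a Borel generator is itself one.
\<close>

lemma const_one: "const 1 = 1"
  by (simp add: const_def)

lemma var_power: "var i ^ n = Poly_Mapping.single (Poly_Mapping.single i n) 1"
  by (induction n) (simp_all add: var_def mult_single flip: single_add)

lemma prod_single_one:
  "(\<Prod>i\<in>A. Poly_Mapping.single (f i) 1) =
    (Poly_Mapping.single (\<Sum>i\<in>A. f i) 1 :: ('n, 'k::comm_ring_1) mpoly)"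
  by (induction A rule: infinite_finite_induct) (simp_all add: mult_single)

lemma psi_monomial:
  "\<exists>b. psi w (Poly_Mapping.single a 1) = Poly_Mapping.single b 1 \<and>
    (\<forall>i. Poly_Mapping.lookup b i = w i * Poly_Mapping.lookup a i)"
proof -
  let ?b = "\<Sum>i\<in>UNIV. Poly_Mapping.single i (w i * Poly_Mapping.lookup a i)"
  have "psi w (Poly_Mapping.single a 1) = Poly_Mapping.single ?b 1"
    unfolding psi_single power_mult[symmetric] unfolding var_power prod_single_one
    by (simp add: const_one)
  moreover have "Poly_Mapping.lookup ?b i = w i * Poly_Mapping.lookup a i" for i
    by (simp add: lookup_sum lookup_single when_def)
  ultimately show ?thesis by blast
qed

lemma psi_in_monomials: "u \<in> monomials \<Longrightarrow> psi w u \<in> monomials"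
  using psi_monomial by (fastforce simp: monomials_def)

text \<open>Positive weights cancel from the exponents \<open>w i * Poly_Mapping.lookup a i\<close>
  of the image.\<close>

lemma inj_on_psi_monomials:
  assumes "\<And>i. 0 < w i"
  shows "inj_on (psi w :: ('n::finite, 'k::field) mpoly \<Rightarrow> _) monomials"
proof (rule inj_onI)
  fix u v :: "('n, 'k) mpoly"
  assume "u \<in> monomials" "v \<in> monomials" and eq: "psi w u = psi w v"
  then obtain a b where uv: "u = Poly_Mapping.single a 1" "v = Poly_Mapping.single b 1"
    by (auto simp: monomials_def)
  obtain a' where a': "psi w u = Poly_Mapping.single a' 1"
    "\<And>i. Poly_Mapping.lookup a' i = w i * Poly_Mapping.lookup a i"
    using psi_monomial uv(1) by metis
  obtain b' where b': "psi w v = Poly_Mapping.single b' 1"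
    "\<And>i. Poly_Mapping.lookup b' i = w i * Poly_Mapping.lookup b i"
    using psi_monomial uv(2) by metis
  \<comment> \<open>The exponent of a monomial is recovered as its only key.\<close>
  have "a' = b'"
    using arg_cong[OF eq, of Poly_Mapping.keys] a'(1) b'(1) by simp
  then have "w i * Poly_Mapping.lookup a i = w i * Poly_Mapping.lookup b i" for i
    using a'(2) b'(2) by metis
  then have "a = b"
    using assms by (intro poly_mapping_eqI) (metis mult_cancel1 less_irrefl)
  then show "u = v" by (simp add: uv)
qed

lemma monomials_mult: "u \<in> monomials \<Longrightarrow> v \<in> monomials \<Longrightarrow> u * v \<in> monomials"
  by (auto simp: monomials_def mult_single)

lemma var_power_monomials: "var i ^ n \<in> monomials"
  by (simp add: monomials_def var_power)

lemma prod_var_power_monomials: "(\<Prod>(i, j)\<leftarrow>ps. var j ^ w j) \<in> monomials"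
proof (induction ps)
  case Nil
  show ?case
    using var_power_monomials[of _ 0] by simp
qed (auto intro: monomials_mult var_power_monomials)

lemma strongly_stable_mult:
  assumes "strongly_stable J" "f \<in> J"
  shows "c * f \<in> J"
  using assms module.subspace_scale[OF module_mult]
  unfolding strongly_stable_def monomial_ideal_iff by blast

text \<open>The \<open>n\<close> factors \<open>var j\<close> move to \<open>var i\<close>, then the
  missing \<open>var i ^ (m - n)\<close> is multiplied in. It serves with \<open>n = w j\<close> and
  \<open>m = w i\<close>, where \<open>n \<le> m\<close> says that the weights decrease.\<close>

lemma strongly_stable_var_power:
  assumes J: "strongly_stable J" and "c \<in> monomials" "c * var j ^ n \<in> J" "i < j" "n \<le> m"
  shows "c * var i ^ m \<in> J"
proof -
  have "borel_move (c * var j ^ n) (c * var i ^ n)"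
    unfolding borel_move_def
    by (intro exI[of _ "replicate n (i, j)"] bexI[of _ c]) (use assms in auto)
  moreover have "c * var j ^ n \<in> monomials"
    by (intro monomials_mult assms var_power_monomials)
  ultimately have "c * var i ^ n \<in> J"
    using assms unfolding strongly_stable_def by blast
  then have "var i ^ (m - n) * (c * var i ^ n) \<in> J"
    by (rule strongly_stable_mult[OF J])
  moreover have "var i ^ (m - n) * (c * var i ^ n) = c * (var i ^ (m - n) * var i ^ n)"
    by (simp add: mult_ac)
  ultimately show ?thesis
    using \<open>n \<le> m\<close> by (simp flip: power_add)
qed

text \<open>The pairs are treated one at a time. The cofactor \<open>c\<close> is arbitrary in the
  induction because each power already moved is absorbed into it.\<close>

lemma strongly_stable_weighted_move:
  assumes J: "strongly_stable J" and w: "antimono w"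
    and "\<forall>(i, j) \<in> set ps. i < j" "c \<in> monomials" "c * (\<Prod>(i, j)\<leftarrow>ps. var j ^ w j) \<in> J"
  shows "c * (\<Prod>(i, j)\<leftarrow>ps. var i ^ w i) \<in> J"
  using assms(3-)
proof (induction ps arbitrary: c)
  case (Cons p ps)
  obtain i j where p: "p = (i, j)" by fastforce
  let ?X = "\<Prod>(i, j)\<leftarrow>ps. var j ^ w j"
  have "i < j" and ps: "\<forall>(i, j) \<in> set ps. i < j"
    using Cons.prems(1) by (simp_all add: p)
  have "(c * ?X) * var j ^ w j = c * (\<Prod>(i, j)\<leftarrow>p # ps. var j ^ w j)"
    by (simp add: p mult_ac)
  then have "(c * ?X) * var j ^ w j \<in> J"
    by (simp only: Cons.prems(3))
  then have "(c * ?X) * var i ^ w i \<in> J"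
    by (rule strongly_stable_var_power[OF J
          monomials_mult[OF Cons.prems(2) prod_var_power_monomials] _ \<open>i < j\<close>
          antimonoD[OF w less_imp_le[OF \<open>i < j\<close>]]])
  then have "(c * var i ^ w i) * ?X \<in> J"
    by (simp only: mult_ac)
  then have "(c * var i ^ w i) * (\<Prod>(i, j)\<leftarrow>ps. var i ^ w i) \<in> J"
    by (rule Cons.IH[OF ps monomials_mult[OF Cons.prems(2) var_power_monomials]])
  then show ?case
    by (simp add: p mult.assoc)
qed simp

lemma psi_one: "psi w 1 = 1"
  using psi_const[of w 1] unfolding const_one .

lemma psi_prod_list: "psi w (\<Prod>x\<leftarrow>xs. f x) = (\<Prod>x\<leftarrow>xs. psi w (f x))"
  by (induction xs) (simp_all add: psi_one psi_mult)

lemma psi_borel_move: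
  assumes "strongly_stable J" "antimono w" "borel_move u v" "psi w u \<in> J"
  shows "psi w v \<in> J"
proof -
  obtain ps c where ps: "\<forall>(i, j) \<in> set ps. i < j" and c: "c \<in> monomials"
    and u: "u = c * (\<Prod>(i, j)\<leftarrow>ps. var j)" and v: "v = c * (\<Prod>(i, j)\<leftarrow>ps. var i)"
    using assms(3) unfolding borel_move_def by blast
  have "psi w c * (\<Prod>(i, j)\<leftarrow>ps. var j ^ w j) \<in> J"
    using assms(4) by (simp add: u psi_mult psi_prod_list case_prod_unfold psi_var)
  then have "psi w c * (\<Prod>(i, j)\<leftarrow>ps. var i ^ w i) \<in> J"
    by (rule strongly_stable_weighted_move[OF assms(1,2) ps psi_in_monomials[OF c]])
  then show ?thesis
    by (simp add: v psi_mult psi_prod_list case_prod_unfold psi_var)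
qed

text \<open>Membership is asked of the image of each term rather than of \<open>psi w f\<close>, so
  that \<open>strongly_stable_keys\<close> applies. For \<open>psi w\<close> injective on monomials
  this set is the preimage of \<open>J\<close>.\<close>

lemma strongly_stable_psi_preimage:
  fixes J :: "('n::{finite,linorder}, 'k::field) mpoly set"
  assumes J: "strongly_stable J" and w: "antimono w"
  shows "strongly_stable
    {f :: ('n, 'k) mpoly. \<forall>a \<in> Poly_Mapping.keys f. psi w (Poly_Mapping.single a 1) \<in> J}"
proof (rule strongly_stable_keys)
  fix a k :: "'n \<Rightarrow>\<^sub>0 nat"
  assume "psi w (Poly_Mapping.single a 1) \<in> J"
  then have "psi w (Poly_Mapping.single k 1 * Poly_Mapping.single a 1) \<in> J"
    by (simp only: psi_mult strongly_stable_mult[OF J])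
  then show "psi w (Poly_Mapping.single (k + a) 1) \<in> J"
    by (simp add: mult_single)
qed (use psi_borel_move[OF J w] in blast)

text \<open>The termwise preimage of \<open>Borel {psi w v}\<close> is strongly stable and contains
  \<open>v\<close>, hence contains \<open>Borel {v}\<close>.\<close>

lemma psi_Borel_single:
  fixes u v :: "('n::{finite,linorder}, 'k::field) mpoly"
  assumes "antimono w" "u \<in> monomials" "v \<in> monomials" "u \<in> Borel {v}"
  shows "psi w u \<in> Borel {psi w v}"
proof -
  let ?P = "{f :: ('n, 'k) mpoly.
    \<forall>a \<in> Poly_Mapping.keys f. psi w (Poly_Mapping.single a 1) \<in> Borel {psi w v}}"
  have "Borel {v} \<subseteq> ?P"
    using assms Borel_superset[of "{psi w v}"]
    by (intro Borel_least strongly_stable_psi_preimage strongly_stable_Borel)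
      (auto simp: monomials_def)
  then show ?thesis
    using assms by (auto simp: monomials_def)
qed

text \<open>Membership in a monomial ideal is decided term by term, so \<open>I\<close> coincides
  with the termwise preimage of \<open>Borel_psi w I\<close>.\<close>

lemma w_stable_imp_strongly_stable:
  fixes I :: "('n::{finite,linorder}, 'k::field) mpoly set"
  assumes "antimono w" "w_stable w I"
  shows "strongly_stable I"
proof -
  have I: "monomial_ideal I" and mem: "\<And>f. f \<in> I \<longleftrightarrow> psi w f \<in> Borel_psi w I"
    using assms(2) by (auto simp: w_stable_def w_closure_def)
  have "f \<in> I \<longleftrightarrow>
      (\<forall>a \<in> Poly_Mapping.keys f. psi w (Poly_Mapping.single a 1) \<in> Borel_psi w I)" for f
    unfolding mem[symmetric] using monomial_ideal_memI[OF I, of f] I[unfolded monomial_ideal_iff]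
    by blast
  then have "I = {f. \<forall>a \<in> Poly_Mapping.keys f. psi w (Poly_Mapping.single a 1) \<in> Borel_psi w I}"
    by (intro set_eqI) (simp only: mem_Collect_eq)
  moreover have "strongly_stable
      {f :: ('n, 'k) mpoly. \<forall>a \<in> Poly_Mapping.keys f. psi w (Poly_Mapping.single a 1) \<in> Borel_psi w I}"
    unfolding Borel_psi_def
    by (rule strongly_stable_psi_preimage[OF strongly_stable_Borel assms(1)])
  ultimately show ?thesis by (rule ssubst[where P = strongly_stable])
qed

text \<open>If \<open>u\<close> and \<open>v\<close> differed, the exponent of each would have
  strictly smaller \<open>height\<close> than that of the other.\<close>

lemma Borel_single_antisym:
  fixes u v :: "('n::{finite,linorder}, 'k::field) mpoly"
  assumes "u \<in> monomials" "v \<in> monomials" "u \<in> Borel {v}" "v \<in> Borel {u}"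
  shows "u = v"
proof -
  obtain a b where "u = Poly_Mapping.single a 1" "v = Poly_Mapping.single b 1"
    using assms by (auto simp: monomials_def)
  then show ?thesis
    using Borel_single_height[of a b, where 'k = 'k] Borel_single_height[of b a, where 'k = 'k] assms
    by auto
qed

text \<open>This trades the definite description for extremality in the partial order
  \<open>u \<in> Borel {v}\<close> on monomials, a condition that can be pulled back along
  \<open>psi w\<close>.\<close>

lemma Bgens_eq:
  fixes J :: "('n::{finite,linorder}, 'k::field) mpoly set"
  assumes J: "strongly_stable J"
  shows "Bgens J = {u \<in> J \<inter> monomials. \<forall>v \<in> J \<inter> monomials. u \<in> Borel {v} \<longrightarrow> v = u}"
    (is "_ = ?M")
proof -
  have "minimal_Borel_generators J (Bgens J)"
    unfolding Bgens_def by (rule theI'[OF minimal_Borel_generators_ex1[OF J]])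
  then have T: "Bgens J \<subseteq> monomials" "Borel (Bgens J) = J"
    "\<And>T'. T' \<subset> Bgens J \<Longrightarrow> Borel T' \<noteq> J"
    by (auto simp: minimal_Borel_generators_def)
  have sub: "Bgens J \<subseteq> J"
    using T(2) Borel_superset by blast
  show ?thesis
  proof
    show "?M \<subseteq> Bgens J"
    proof
      \<comment> \<open>A single generator \<open>t\<close> already produces \<open>u\<close>;
        extremality of \<open>u\<close> forces \<open>t = u\<close>.\<close>
      fix u assume u: "u \<in> ?M"
      then obtain t where "t \<in> Bgens J" "u \<in> Borel {t}"
        using Borel_pointwise[OF T(1), of u] T(2) by blast
      then show "u \<in> Bgens J"
        using u sub T(1) by blast
    qed
    have "v = u" if u: "u \<in> Bgens J" and v: "v \<in> J" "v \<in> monomials" "u \<in> Borel {v}" for u v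
    proof -
      \<comment> \<open>Now \<open>t\<close> produces \<open>v\<close> and \<open>v\<close> produces
        \<open>u\<close>; once \<open>t = u\<close>, antisymmetry gives
        \<open>v = u\<close>.\<close>
      obtain t where t: "t \<in> Bgens J" "v \<in> Borel {t}"
        using Borel_pointwise[OF T(1), of v] T(2) v by blast
      have "t = u"
      proof (rule ccontr)
        assume "t \<noteq> u"
        \<comment> \<open>Otherwise the remaining generators still produce \<open>u\<close>, so
          dropping \<open>u\<close> contradicts minimality.\<close>
        let ?T = "Bgens J - {u}"
        have "u \<in> Borel {t}"
          using Borel_trans[OF v(3) t(2)] .
        moreover have "t \<in> Borel ?T"
          using t(1) \<open>t \<noteq> u\<close> Borel_superset[of ?T] by blast
        ultimately have "u \<in> Borel ?T"
          by (rule Borel_trans)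
        then have "Bgens J \<subseteq> Borel ?T"
          using Borel_superset[of ?T] by blast
        then have "J \<subseteq> Borel ?T"
          using Borel_least[OF strongly_stable_Borel] T(2) by metis
        moreover have "Borel ?T \<subseteq> J"
          using sub by (intro Borel_least[OF J]) blast
        ultimately show False
          using T(3)[of ?T] u by blast
      qed
      then show ?thesis
        using Borel_single_antisym[of v u] t(2) u v T(1) by blast
    qed
    then show "Bgens J \<subseteq> ?M"
      using sub T(1) by blast
  qed
qed

theorem proposition2p16:
  fixes w :: "'n::{finite,linorder} \<Rightarrow> nat"
    and I :: "('n, 'k::field) mpoly set"
  assumes "weight_vector w"
    and "monomial_ideal I"
    and "w_stable w I"
  shows "weighted_Bgens w I \<subseteq> Bgens I"
proof
  fix u assume "u \<in> weighted_Bgens w I"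
  then have u: "u \<in> monomials" and gen: "psi w u \<in> Bgens (Borel_psi w I)"
    by (auto simp: weighted_Bgens_def)
  have w: "antimono w" and pos: "\<And>i. 0 < w i"
    using assms(1) by (auto simp: weight_vector_def)
  have mem: "f \<in> I \<longleftrightarrow> psi w f \<in> Borel_psi w I" for f
    using assms(3) by (auto simp: w_stable_def w_closure_def)
  have gens: "Bgens (Borel_psi w I) = {u \<in> Borel_psi w I \<inter> monomials.
      \<forall>v \<in> Borel_psi w I \<inter> monomials. u \<in> Borel {v} \<longrightarrow> v = u}"
    unfolding Borel_psi_def by (rule Bgens_eq[OF strongly_stable_Borel])
  \<comment> \<open>A monomial \<open>v\<close> of \<open>I\<close> producing \<open>u\<close> has
    an image in \<open>Borel_psi w I\<close> producing \<open>psi w u\<close>; extremality of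
    \<open>psi w u\<close> identifies the images.\<close>
  have "v = u" if v: "v \<in> I" "v \<in> monomials" "u \<in> Borel {v}" for v
  proof -
    have "psi w v = psi w u"
      using gen[unfolded gens] psi_Borel_single[OF w u v(2,3)] mem[of v] v(1)
        psi_in_monomials[OF v(2)] by simp
    then show ?thesis
      by (rule inj_onD[OF inj_on_psi_monomials[OF pos] _ v(2) u])
  qed
  \<comment> \<open>As a generator, \<open>psi w u\<close> lies in \<open>Borel_psi w I\<close>, and
    \<open>w\<close>-stability pulls this back to \<open>u\<close>.\<close>
  moreover have "u \<in> I"
    using gen[unfolded gens] mem[of u] by simp
  ultimately show "u \<in> Bgens I"
    using u by (simp add: Bgens_eq[OF w_stable_imp_strongly_stable[OF w assms(3)]])
qed

end
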